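(* Let $d\ge 2$ and let $C:[0,1]^d\to[0,1]$ be a copula. For $K\ge 1$ and $p^{(1)},\dots,p^{(K)}\in(0,1)$ with $\sum_{k=1}^K p^{(k)}=1$, let $\tilde C^{(K)}$ be the (Liebscher) copula $$\tilde C^{(K)}(u_1,\dots,u_d)=\prod_{k=1}^K C\big(u_1^{p^{(k)}},\dots,u_d^{p^{(k)}}\big),\qquad (u_1,\dots,u_d)\in[0,1]^d.$$ Then $\tilde C^{(K)}=C$ for all $K\ge 1$ and all sequences $p^{(1)},\dots,p^{(K)}\in(0,1)$ such that $\sum_{k=1}^K p^{(k)}=1$ if and only if $C$ is max-stable.
   Context: A copula $C$ on $[0,1]^d$ is max-stable if $C(u_1^{1/n},\dots,u_d^{1/n})^n=C(u_1,\dots,u_d)$ for all integers $n\ge1$ and all $(u_1,\dots,u_d)\in[0,1]^d$. *)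

theory Defs
  imports "HOL-Analysis.Analysis"
begin

text \<open>
  A function on the unit cube is represented by a total function on \<^typ>\<open>real ^ 'd\<close>;
  only its values on \<^term>\<open>cbox 0 1 :: (real ^ 'd) set\<close> are ever constrained or compared.
\<close>

text \<open>
  The C-volume of the box with lower corner \<open>a\<close> and upper corner \<open>b\<close>: the alternating sum of
  \<open>C\<close> over the vertices, where \<open>J\<close> is the set of coordinates at which the vertex agrees with \<open>a\<close>.
\<close>

definition box_volume :: "(real ^ 'd \<Rightarrow> real) \<Rightarrow> real ^ 'd \<Rightarrow> real ^ 'd \<Rightarrow> real" where
  "box_volume C a b =
     (\<Sum>J\<in>(UNIV :: 'd set set). (-1) ^ card J * C (\<chi> i. if i \<in> J then a $ i else b $ i))"

text \<open>
  Range in the unit interval, groundedness, uniform margins, and nonnegative volume of every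
  subbox: these say that \<open>C\<close> is the restriction to the unit cube of a multivariate distribution
  function whose univariate margins are uniform on the unit interval.
\<close>

definition copula :: "(real ^ 'd \<Rightarrow> real) \<Rightarrow> bool" where
  "copula C \<longleftrightarrow>
     (\<forall>u\<in>cbox 0 1. C u \<in> {0..1}) \<and>
     (\<forall>u\<in>cbox 0 1. (\<exists>i. u $ i = 0) \<longrightarrow> C u = 0) \<and>
     (\<forall>i. \<forall>t\<in>{0..1}. C (\<chi> j. if j = i then t else 1) = t) \<and>
     (\<forall>a\<in>cbox 0 1. \<forall>b\<in>cbox 0 1. (\<forall>i. a $ i \<le> b $ i) \<longrightarrow> 0 \<le> box_volume C a b)"

text \<open>
  Below, \<open>powr\<close> is applied to nonnegative bases with positive exponents only; there
  \<open>0 powr p = 0\<close>, as for ordinary powers.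
\<close>

definition max_stable :: "(real ^ 'd \<Rightarrow> real) \<Rightarrow> bool" where
  "max_stable C \<longleftrightarrow>
     (\<forall>n::nat. 1 \<le> n \<longrightarrow>
        (\<forall>u\<in>cbox 0 1. C (\<chi> i. u $ i powr (1 / real n)) ^ n = C u))"

definition liebscher ::
    "(real ^ 'd \<Rightarrow> real) \<Rightarrow> nat \<Rightarrow> (nat \<Rightarrow> real) \<Rightarrow> real ^ 'd \<Rightarrow> real" where
  "liebscher C K p u = (\<Prod>k=1..K. C (\<chi> i. u $ i powr p k))"

end

theory Submission imports Defs begin

text \<open>
  One direction is the special case of equal weights \<open>1 / n\<close>. For the other, write
  \<open>u\<^sup>t\<close> for the componentwise power. Max-stability gives \<open>C (u\<^sup>q) = C(u)\<^sup>q\<close> for the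
  exponents \<open>q = 1 / n\<close>; replacing \<open>u\<close> by \<open>u\<^sup>m\<close> turns this into the same law for positive
  integers \<open>m\<close>, and the two combine to all positive rationals. Now \<open>t \<mapsto> C (u\<^sup>t)\<close> is
  antitone, because \<open>u\<close> lies in the unit cube and a copula is monotone, while
  \<open>t \<mapsto> C(u)\<^sup>t\<close> is continuous. Squeezing between rationals therefore gives
  \<open>C (u\<^sup>t) = C(u)\<^sup>t\<close> for every real \<open>t > 0\<close>, and in the Liebscher product the exponents add
  up to one.

  The law for real exponents (\<open>max_stable_powr\<close>) thus carries the proof. It rests on
  monotonicity of copulas (\<open>copula_mono\<close>), where the nonnegativity of box
  volumes enters.
\<close>

section \<open>Monotonicity of copulas\<close>

text \<open>
  Extend the segment from the changed to the original point to a box reaching down to \<open>0\<close> in all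
  coordinates other than \<open>i\<close>. As \<open>C\<close> is grounded, every vertex of that box contributes nothing
  to its volume except the two endpoints of the segment, so the volume is the increment of \<open>C\<close>.
\<close>

lemma copula_mono_coordinate:
  fixes C :: "real ^ 'd \<Rightarrow> real"
  assumes C: "copula C" and b: "b \<in> cbox 0 1" and s: "0 \<le> s" "s \<le> b $ i"
  shows "C (\<chi> j. if j = i then s else b $ j) \<le> C b"
proof -
  define a :: "real ^ 'd" where "a = (\<chi> j. if j = i then s else 0)"
  define f where "f J = (-1) ^ card J * C (\<chi> j. if j \<in> J then a $ j else b $ j)" for J
  have b01: "0 \<le> b $ j" "b $ j \<le> 1" for j
    using b by (auto simp: mem_box_cart)
  have a: "a \<in> cbox 0 1" and ab: "\<forall>j. a $ j \<le> b $ j"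
    using s b01 order_trans[OF s(2) b01(2)] by (auto simp: mem_box_cart a_def)
  have "f J = 0" if "J \<in> UNIV - {{}, {i}}" for J
  proof -
    from that obtain j where j: "j \<in> J" "j \<noteq> i" by auto
    let ?v = "\<chi> j. if j \<in> J then a $ j else b $ j"
    have "?v \<in> cbox 0 1" "?v $ j = 0"
      using a b01 j by (auto simp: mem_box_cart a_def)
    then have "C ?v = 0" using C unfolding copula_def by blast
    then show ?thesis by (simp add: f_def)
  qed
  then have "sum f UNIV = sum f {{}, {i}}"
    by (intro sum.mono_neutral_right) auto
  also have "\<dots> = C b - C (\<chi> j. if j = i then s else b $ j)"
  proof -
    have "(\<chi> j. if j \<in> {i} then a $ j else b $ j) = (\<chi> j. if j = i then s else b $ j)"
      by (simp add: vec_eq_iff a_def)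
    then show ?thesis by (simp add: f_def)
  qed
  finally have "box_volume C a b = C b - C (\<chi> j. if j = i then s else b $ j)"
    by (simp add: box_volume_def f_def)
  moreover have "0 \<le> box_volume C a b"
    using C a b ab unfolding copula_def by blast
  ultimately show ?thesis by simp
qed

lemma copula_mono:
  fixes C :: "real ^ 'd \<Rightarrow> real"
  assumes C: "copula C" and a: "a \<in> cbox 0 1" and b: "b \<in> cbox 0 1"
    and ab: "\<And>j. a $ j \<le> b $ j"
  shows "C a \<le> C b"
proof -
  have "C (\<chi> j. if j \<in> S then a $ j else b $ j) \<le> C b" if "finite S" for S
    using that
  proof induction
    case empty
    then show ?case by simp
  next
    case (insert i S)
    let ?v = "\<chi> j. if j \<in> S then a $ j else b $ j"
    have "?v \<in> cbox 0 1" using a b by (auto simp: mem_box_cart)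
    moreover have "0 \<le> a $ i" "a $ i \<le> ?v $ i"
      using a ab insert.hyps by (auto simp: mem_box_cart)
    ultimately have "C (\<chi> j. if j = i then a $ i else ?v $ j) \<le> C ?v"
      by (intro copula_mono_coordinate[OF C])
    moreover have "(\<chi> j. if j = i then a $ i else ?v $ j)
        = (\<chi> j. if j \<in> insert i S then a $ j else b $ j)"
      by (auto simp: vec_eq_iff)
    ultimately show ?case using insert.IH by simp
  qed
  from this[of UNIV] show ?thesis by simp
qed

section \<open>The power law for max-stable copulas\<close>

lemma powr_vec_mem_unit_cube:
  fixes u :: "real ^ 'd"
  assumes "u \<in> cbox 0 1" "0 \<le> t"
  shows "(\<chi> i. u $ i powr t) \<in> cbox 0 1"
  using assms by (auto simp: mem_box_cart powr_le1)

lemma powr_one_vec: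
  fixes u :: "real ^ 'd"
  assumes "u \<in> cbox 0 1"
  shows "(\<chi> i. u $ i powr 1) = u"
  using assms by (auto simp: mem_box_cart vec_eq_iff)

lemma copula_powr_antimono:
  fixes C :: "real ^ 'd \<Rightarrow> real"
  assumes C: "copula C" and u: "u \<in> cbox 0 1" and st: "0 < s" "s \<le> t"
  shows "C (\<chi> i. u $ i powr t) \<le> C (\<chi> i. u $ i powr s)"
proof (rule copula_mono[OF C])
  show "(\<chi> i. u $ i powr t) $ j \<le> (\<chi> i. u $ i powr s) $ j" for j
  proof (cases "u $ j = 0")
    case False
    then have "0 < u $ j" "u $ j \<le> 1"
      using u by (auto simp: mem_box_cart order_less_le)
    then show ?thesis using st by (simp add: powr_mono')
  qed simp
qed (use u st in \<open>auto intro: powr_vec_mem_unit_cube\<close>)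

text \<open>
  For \<open>t = m / n\<close>, max-stability of order \<open>m\<close> at \<open>u\<^sup>m\<close> reads \<open>C (u\<^sup>m) = C(u)\<^sup>m\<close>, and of
  order \<open>n\<close> at the same point it reads \<open>C (u\<^sup>t)\<^sup>n = C (u\<^sup>m)\<close>; then extract the \<open>n\<close>-th root.
\<close>

lemma max_stable_powr_rational:
  fixes C :: "real ^ 'd \<Rightarrow> real"
  assumes C: "copula C" and ms: "max_stable C" and u: "u \<in> cbox 0 1"
    and t: "t \<in> \<rat>" "0 < t"
  shows "C (\<chi> i. u $ i powr t) = C u powr t"
proof -
  obtain m n :: nat where n: "n \<noteq> 0" and "\<bar>t\<bar> = real m / real n"
    using Rats_abs_nat_div_natE[OF t(1)] by metis
  with t have tmn: "t = real m / real n" by simp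
  with t have m: "m \<noteq> 0" by (intro notI) simp
  have nonneg: "0 \<le> C v" if "v \<in> cbox 0 1" for v
    using C that unfolding copula_def by auto
  define w where "w = (\<chi> i. u $ i powr real m)"
  have w: "w \<in> cbox 0 1" using u unfolding w_def by (intro powr_vec_mem_unit_cube) auto
  have root: "C (\<chi> i. w $ i powr (1 / real k)) ^ k = C w" if "k \<noteq> 0" for k
    using ms w that unfolding max_stable_def by simp
  have "(\<chi> i. w $ i powr (1 / real m)) = u"
    using powr_one_vec[OF u] m by (simp add: w_def powr_powr)
  with root[OF m] have wm: "C w = C u ^ m" by simp
  have "(\<chi> i. w $ i powr (1 / real n)) = (\<chi> i. u $ i powr t)"
    by (simp add: w_def powr_powr tmn)
  with root[OF n] wm have "C (\<chi> i. u $ i powr t) ^ n = C u ^ m" by simp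
  also have "\<dots> = (C u powr t) ^ n"
    using nonneg[OF u] m n by (simp add: tmn powr_powr flip: powr_realpow')
  finally show ?thesis
    by (rule power_eq_imp_eq_base)
      (use n t u in \<open>auto intro!: nonneg powr_vec_mem_unit_cube\<close>)
qed

lemma max_stable_powr:
  fixes C :: "real ^ 'd \<Rightarrow> real"
  assumes C: "copula C" and ms: "max_stable C" and u: "u \<in> cbox 0 1" and t: "0 < t"
  shows "C (\<chi> i. u $ i powr t) = C u powr t"
proof -
  define g where "g s = C (\<chi> i. u $ i powr s)" for s
  have g_anti: "g r \<le> g s" if "0 < s" "s \<le> r" for s r
    using copula_powr_antimono[OF C u that] by (simp add: g_def)
  have g_rat: "g q = C u powr q" if "q \<in> \<rat>" "0 < q" for q
    using max_stable_powr_rational[OF C ms u that] by (simp add: g_def)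
  have g_nonneg: "0 \<le> g t"
    using C powr_vec_mem_unit_cube[OF u, of t] t unfolding copula_def g_def by auto
  show ?thesis
  proof (cases "C u = 0")
    case True
    \<comment> \<open>Here \<open>s \<mapsto> C(u)\<^sup>s\<close> vanishes identically, so one rational exponent below \<open>t\<close> suffices.\<close>
    obtain q where "q \<in> \<rat>" "0 < q" "q < t" using Rats_dense_in_real[OF t] by auto
    then have "g t \<le> 0" using g_anti[of q t] g_rat[of q] True by simp
    with g_nonneg True show ?thesis by (simp add: g_def)
  next
    case False
    have cont: "((\<lambda>s. C u powr s) \<longlongrightarrow> C u powr t) (at t within S)" for S
      using False by (intro tendsto_intros) auto
    have "\<not> g t < C u powr t"
    proof
      assume "g t < C u powr t"
      then have "eventually (\<lambda>s. g t < C u powr s) (at_right t)"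
        by (rule order_tendstoD(1)[OF cont])
      then obtain r where r: "t < r" "\<And>s. t < s \<Longrightarrow> s < r \<Longrightarrow> g t < C u powr s"
        unfolding eventually_at_right_field by blast
      obtain q where "q \<in> \<rat>" "t < q" "q < r" using Rats_dense_in_real[OF r(1)] by auto
      then show False using r(2)[of q] g_rat[of q] g_anti[of t q] t by simp
    qed
    moreover have "\<not> C u powr t < g t"
    proof
      assume "C u powr t < g t"
      then have "eventually (\<lambda>s. C u powr s < g t) (at_left t)"
        by (rule order_tendstoD(2)[OF cont])
      then obtain r where r: "r < t" "\<And>s. r < s \<Longrightarrow> s < t \<Longrightarrow> C u powr s < g t"
        unfolding eventually_at_left_field by blast
      have "max 0 r < t" using r(1) t by simp
      then obtain q where "q \<in> \<rat>" "max 0 r < q" "q < t"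
        using Rats_dense_in_real by blast
      then show False using r(2)[of q] g_rat[of q] g_anti[of q t] by simp
    qed
    ultimately show ?thesis by (simp add: g_def)
  qed
qed

section \<open>Invariance under the Liebscher construction\<close>

lemma liebscher_eq_if_max_stable:
  fixes C :: "real ^ 'd \<Rightarrow> real"
  assumes C: "copula C" and ms: "max_stable C" and u: "u \<in> cbox 0 1"
    and p: "\<And>k. k \<in> {1..K} \<Longrightarrow> 0 < p k" and sum: "(\<Sum>k=1..K. p k) = 1"
  shows "liebscher C K p u = C u"
proof -
  have "0 \<le> C u" using C u unfolding copula_def by auto
  have "liebscher C K p u = (\<Prod>k=1..K. C u powr p k)"
    unfolding liebscher_def by (intro prod.cong refl max_stable_powr[OF C ms u] p)
  also have "\<dots> = C u"
  proof (cases "C u = 0")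
    case True
    \<comment> \<open>Exponents do not add up in base \<open>0\<close>, as \<open>0 powr 0\<close> is \<open>0\<close> and the empty product is \<open>1\<close>;
      the weights sum to \<open>1\<close>, so there is a factor, and it is \<open>0\<close>.\<close>
    from sum have "K \<noteq> 0" by (intro notI) simp
    with True show ?thesis by simp
  next
    case False
    then have "(\<Prod>k=1..K. C u powr p k) = C u powr (\<Sum>k=1..K. p k)"
      by (simp add: powr_sum)
    with sum \<open>0 \<le> C u\<close> show ?thesis by simp
  qed
  finally show ?thesis .
qed

lemma liebscher_equal_weights:
  "liebscher C n (\<lambda>_. t) u = C (\<chi> i. u $ i powr t) ^ n"
  by (simp add: liebscher_def)

theorem proposition4:
  fixes C :: "real ^ 'd \<Rightarrow> real"
  assumes "CARD('d) \<ge> 2"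
    and "copula C"
  shows "(\<forall>K::nat. \<forall>p::nat \<Rightarrow> real.
            1 \<le> K \<longrightarrow> (\<forall>k\<in>{1..K}. p k \<in> {0<..<1}) \<longrightarrow> (\<Sum>k=1..K. p k) = 1 \<longrightarrow>
            (\<forall>u\<in>cbox 0 1. liebscher C K p u = C u))
         \<longleftrightarrow> max_stable C"
    (is "?invariant \<longleftrightarrow> _")
proof
  assume inv: ?invariant
  show "max_stable C"
    unfolding max_stable_def
  proof (intro allI impI ballI)
    fix n :: nat and u :: "real ^ 'd"
    assume n: "1 \<le> n" and u: "u \<in> cbox 0 1"
    show "C (\<chi> i. u $ i powr (1 / real n)) ^ n = C u"
    proof (cases "n = 1")
      \<comment> \<open>A single weight would have to be \<open>1\<close>, which is outside the open interval, so the
        hypothesis is void here.\<close>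
      case True
      then show ?thesis using powr_one_vec[OF u] by simp
    next
      case False
      with n have "\<forall>k\<in>{1..n}. 1 / real n \<in> {0<..<1}" "(\<Sum>k=1..n. 1 / real n) = 1"
        by auto
      with inv[THEN spec, THEN spec, of n "\<lambda>_. 1 / real n"] n u
      have "liebscher C n (\<lambda>_. 1 / real n) u = C u" by blast
      then show ?thesis by (simp add: liebscher_equal_weights)
    qed
  qed
next
  assume "max_stable C"
  with assms(2) show ?invariant
    by (auto intro!: liebscher_eq_if_max_stable)
qed

end
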